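(* Consider the rotor-router growth model on $\mathbb{Z}^2$ with any total ordering $\epsilon_0<\epsilon_1<\epsilon_2<\epsilon_3$ of $E_2=\{\pm e_1,\pm e_2\}$. Let $\epsilon>0$. If $m$ is sufficiently large (depending on $\epsilon$), then after $m$ particles have been deposited and allowed to equilibrate, every site of $\mathbb{Z}^2$ in the open disc centered at the origin of radius $r_0=\left(\frac{8m}{3e^{6+\epsilon}}\right)^{1/4}$ is occupied.
   Context: Growth process: initially no site is occupied; each particle is placed at the origin; while it is at an occupied site $x$ it moves to $x+(\text{rotor direction at }x)$ and the rotor at $x$ is then advanced to the next direction in the cyclic order $\epsilon_0\to\epsilon_1\to\epsilon_2\to\epsilon_3\to\epsilon_0$; when it reaches an unoccupied site it stops there and that site becomes occupied with rotor $\epsilon_0$. Particles are deposited one at a time, each one moving until it stops before the next is deposited. *)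

theory Defs
  imports "HOL-Analysis.Analysis" "HOL-Library.While_Combinator"
begin

type_synonym site = "int \<times> int"

definition E2 :: "site set" where
  "E2 = {(1, 0), (-1, 0), (0, 1), (0, -1)}"

text \<open>The ordering \<open>\<epsilon>\<^sub>0 < \<epsilon>\<^sub>1 < \<epsilon>\<^sub>2 < \<epsilon>\<^sub>3\<close> is given by its enumeration \<open>dir i = \<epsilon>\<^sub>i\<close>; only the
  values at \<open>i < 4\<close> matter.\<close>

definition direction_order :: "(nat \<Rightarrow> site) \<Rightarrow> bool" where
  "direction_order dir \<longleftrightarrow> bij_betw dir {..<4} E2"

text \<open>The domain of a configuration is the set of occupied sites; \<open>\<rho> x = Some i\<close> means that the rotor
  at \<open>x\<close> has direction \<open>\<epsilon>\<^sub>i\<close>.\<close>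

type_synonym config = "site \<rightharpoonup> nat"

definition rotor_step :: "(nat \<Rightarrow> site) \<Rightarrow> site \<times> config \<Rightarrow> site \<times> config" where
  "rotor_step dir = (\<lambda>(x, \<rho>). (x + dir (the (\<rho> x)), \<rho>(x \<mapsto> Suc (the (\<rho> x)) mod 4)))"

text \<open>The result is \<open>None\<close> precisely when the new particle never reaches an unoccupied site.\<close>

definition deposit :: "(nat \<Rightarrow> site) \<Rightarrow> config \<Rightarrow> config option" where
  "deposit dir \<rho> =
     map_option (\<lambda>(x, \<rho>'). \<rho>'(x \<mapsto> 0))
       (while_option (\<lambda>(x, \<rho>'). x \<in> dom \<rho>') (rotor_step dir) ((0, 0), \<rho>))"

fun rotor_growth :: "(nat \<Rightarrow> site) \<Rightarrow> nat \<Rightarrow> config option" where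
  "rotor_growth dir 0 = Some Map.empty"
| "rotor_growth dir (Suc m) = Option.bind (rotor_growth dir m) (deposit dir)"

end

theory Submission
  imports Defs
begin

text \<open>If the rotor at \<open>z\<close> has made \<open>j\<close> steps of its current turn, it has contributed the first \<open>j\<close>
  increments of \<open>f\<close> around \<open>z\<close>; a full turn contributes the discrete Laplacian of \<open>f\<close> at \<open>z\<close>. Hence,
  if \<open>f\<close> is superharmonic on the occupied sites, then \<open>f\<close> at the particle minus these contributions
  never increases, and the sum of \<open>f\<close> over the \<open>m\<close> occupied sites is at most \<open>m * f 0\<close> plus an
  error of order \<open>m\<close>. If \<open>p\<close> is vacant, this applies to \<open>f z = ln (\<bar>z - p\<bar>\<^sup>2 - 1/2)\<close>, which is
  superharmonic off \<open>p\<close> because the product of the four neighbouring values of \<open>\<bar>z\<bar>\<^sup>2 - 1/2\<close> at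
  \<open>z = (x, y)\<close> is \<open>(\<bar>z\<bar>\<^sup>2 - 1/2)\<^sup>4 - 4 (x\<^sup>2 - y\<^sup>2)\<^sup>2\<close>. As \<open>m\<close> distinct sites have a sum of
  logarithms of about \<open>m ln m\<close>, \<open>p\<close> cannot be as close to the origin as \<open>m\<^bsup>1/4\<^esup>\<close>. The same potential
  with \<open>f z = - \<bar>z\<bar>\<^sup>2\<close> strictly decreases, so every particle stops.\<close>

section \<open>The rotor potential\<close>

text \<open>The parameter \<open>c\<close> is the change allowed to the potential per rotor step: 0
  gives a monotone quantity, -1 a strictly decreasing one that serves for termination.\<close>

definition rotor_weight :: "(nat \<Rightarrow> site) \<Rightarrow> (site \<Rightarrow> real) \<Rightarrow> real \<Rightarrow> config \<Rightarrow> site \<Rightarrow> real" where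
  "rotor_weight dir f c \<rho> z = (\<Sum>j<the (\<rho> z). f z - f (z + dir j) + c)"

definition rotor_potential :: "(nat \<Rightarrow> site) \<Rightarrow> (site \<Rightarrow> real) \<Rightarrow> real \<Rightarrow> site \<times> config \<Rightarrow> real" where
  "rotor_potential dir f c = (\<lambda>(x, \<rho>). f x + (\<Sum>z\<in>dom \<rho>. rotor_weight dir f c \<rho> z))"

definition valid_config :: "config \<Rightarrow> bool" where
  "valid_config \<rho> \<longleftrightarrow> finite (dom \<rho>) \<and> (\<forall>z\<in>dom \<rho>. the (\<rho> z) < 4)"

lemma valid_config_upd: "valid_config \<rho> \<Longrightarrow> k < 4 \<Longrightarrow> valid_config (\<rho>(x \<mapsto> k))"
  by (auto simp: valid_config_def)

text \<open>Before the rotor wraps, the increment of \<open>f\<close> along the particle's move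
  cancels against the new term of \<open>rotor_weight\<close>, leaving exactly \<open>c\<close>. At
  the wrap from 3 to 0 the three stored terms disappear, and \<open>lap\<close> bounds the
  result.\<close>

lemma rotor_potential_step:
  assumes \<rho>: "valid_config \<rho>" and x: "x \<in> dom \<rho>"
    and lap: "(\<Sum>j<4. f (x + dir j)) \<le> 4 * f x + 4 * c"
  shows "rotor_potential dir f c (rotor_step dir (x, \<rho>)) \<le> rotor_potential dir f c (x, \<rho>) + c"
proof -
  define k where "k = the (\<rho> x)"
  define \<rho>' where "\<rho>' = \<rho>(x \<mapsto> Suc k mod 4)"
  have fin: "finite (dom \<rho>)" and k: "k < 4"
    using \<rho> x by (auto simp: valid_config_def k_def)
  have step: "rotor_step dir (x, \<rho>) = (x + dir k, \<rho>')"
    by (simp add: rotor_step_def k_def \<rho>'_def)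
  have dom: "dom \<rho>' = dom \<rho>"
    using x by (auto simp: \<rho>'_def)
  have other: "(\<Sum>z\<in>dom \<rho> - {x}. rotor_weight dir f c \<rho>' z)
      = (\<Sum>z\<in>dom \<rho> - {x}. rotor_weight dir f c \<rho> z)"
    by (rule sum.cong) (auto simp: rotor_weight_def \<rho>'_def)
  have turn: "f (x + dir k) + rotor_weight dir f c \<rho>' x \<le> f x + rotor_weight dir f c \<rho> x + c"
  proof (cases "k = 3")
    case True
    then show ?thesis
      using lap by (simp add: rotor_weight_def \<rho>'_def flip: k_def) (simp add: eval_nat_numeral)
  next
    case False
    with k have "Suc k mod 4 = Suc k" by simp
    then show ?thesis
      by (simp add: rotor_weight_def \<rho>'_def flip: k_def)
  qed
  show ?thesis
    unfolding step rotor_potential_def prod.case dom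
    using turn by (simp add: sum.remove[OF fin x] other)
qed

lemma sum_dir:
  assumes "direction_order dir"
  shows "(\<Sum>j<4. g (dir j)) = (\<Sum>e\<in>E2. g e)"
  using assms by (simp add: direction_order_def sum.reindex_bij_betw)

lemma sum_E2: "(\<Sum>e\<in>E2. g e) = g (1, 0) + g (-1, 0) + g (0, 1) + g (0, -1)" for g :: "site \<Rightarrow> real"
  by (simp add: E2_def)

section \<open>Depositing particles\<close>

lemma deposit_loop_terminates:
  assumes dir: "direction_order dir" and \<rho>: "valid_config \<rho>"
  shows "\<exists>t. while_option (\<lambda>(x, \<rho>'). x \<in> dom \<rho>') (rotor_step dir) (x, \<rho>) = Some t"
proof -
  \<comment> \<open>The four neighbouring values of minus the squared norm add up to
    \<open>4 * f z - 4\<close>, so \<open>c = -1\<close> is admissible and every step lowers the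
    potential by at least 1.\<close>
  define f :: "site \<Rightarrow> real" where "f = (\<lambda>(a, b). - (of_int a ^ 2 + of_int b ^ 2))"
  define P where "P = rotor_potential dir f (-1)"
  define w where "w z = (\<Sum>j<4. \<bar>f z - f (z + dir j) - 1\<bar>)" for z
  \<comment> \<open>A moving particle changes no domain, so the two sums bound the potential from
    below while the particle is on an occupied site. The extra 1 keeps \<open>P s + B\<close> at
    least 1 there, so that a drop by 1 survives \<open>nat\<close> and the floor.\<close>
  define B where "B = 1 + (\<Sum>z\<in>dom \<rho>. \<bar>f z\<bar>) + (\<Sum>z\<in>dom \<rho>. w z)"
  define inv where "inv = (\<lambda>(y :: site, \<rho>'). valid_config \<rho>' \<and> dom \<rho>' = dom \<rho>)"
  have fin: "finite (dom \<rho>)"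
    using \<rho> by (simp add: valid_config_def)
  have lap: "(\<Sum>j<4. f (z + dir j)) \<le> 4 * f z + 4 * (-1)" for z
    using sum_dir[OF dir, of "\<lambda>e. f (z + e)"]
    by (cases z) (simp add: sum_E2 f_def power2_eq_square algebra_simps)
  have lower: "P (y, \<rho>') + B \<ge> 1" if "inv (y, \<rho>')" "y \<in> dom \<rho>'" for y \<rho>'
  proof -
    have val: "valid_config \<rho>'" and dom: "dom \<rho>' = dom \<rho>"
      using that by (auto simp: inv_def)
    have weight: "- w z \<le> rotor_weight dir f (-1) \<rho>' z" if "z \<in> dom \<rho>" for z
    proof -
      have "the (\<rho>' z) < 4"
        using val dom that by (auto simp: valid_config_def)
      have "- rotor_weight dir f (-1) \<rho>' z \<le> (\<Sum>j<the (\<rho>' z). \<bar>f z - f (z + dir j) - 1\<bar>)"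
        unfolding rotor_weight_def sum_negf[symmetric] by (rule sum_mono) linarith
      also have "\<dots> \<le> w z"
        unfolding w_def using \<open>the (\<rho>' z) < 4\<close> by (intro sum_mono2) auto
      finally show ?thesis by simp
    qed
    have "\<bar>f y\<bar> \<le> (\<Sum>z\<in>dom \<rho>. \<bar>f z\<bar>)"
      using that dom fin by (intro member_le_sum) auto
    moreover have "- (\<Sum>z\<in>dom \<rho>. w z) \<le> (\<Sum>z\<in>dom \<rho>. rotor_weight dir f (-1) \<rho>' z)"
      unfolding sum_negf[symmetric] by (rule sum_mono) (rule weight)
    ultimately show ?thesis
      by (simp add: P_def rotor_potential_def B_def dom)
  qed
  show ?thesis
  proof (rule measure_while_option_Some[where P = inv and f = "\<lambda>s. nat \<lfloor>P s + B\<rfloor>"])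
    show "inv (x, \<rho>)"
      using \<rho> by (simp add: inv_def)
    fix s
    assume s: "inv s" "case s of (x, \<rho>') \<Rightarrow> x \<in> dom \<rho>'"
    obtain y \<rho>' where [simp]: "s = (y, \<rho>')" by (cases s)
    have "valid_config \<rho>'" "dom \<rho>' = dom \<rho>" "y \<in> dom \<rho>'"
      using s by (auto simp: inv_def)
    then have "inv (rotor_step dir s)"
      by (auto simp: inv_def rotor_step_def intro!: valid_config_upd)
    moreover have "P (rotor_step dir s) \<le> P s - 1"
      using rotor_potential_step[OF \<open>valid_config \<rho>'\<close> \<open>y \<in> dom \<rho>'\<close> lap] by (simp add: P_def)
    moreover have "P s + B \<ge> 1"
      using lower s by simp
    ultimately show "inv (rotor_step dir s) \<and> nat \<lfloor>P (rotor_step dir s) + B\<rfloor> < nat \<lfloor>P s + B\<rfloor>"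
      by (intro conjI) (assumption, linarith)
  qed
qed

text \<open>The quantifier over \<open>f\<close> stays inside because the function used later
  depends on a site that is vacant at the end, after all deposits.\<close>

lemma deposit_invariant:
  assumes dir: "direction_order dir" and \<rho>: "valid_config \<rho>"
  shows "\<exists>x \<rho>'. deposit dir \<rho> = Some (\<rho>'(x \<mapsto> 0)) \<and> valid_config \<rho>' \<and>
    dom \<rho>' = dom \<rho> \<and> x \<notin> dom \<rho> \<and>
    (\<forall>f. (\<forall>z\<in>dom \<rho>. (\<Sum>j<4. f (z + dir j)) \<le> 4 * f z) \<longrightarrow>
      rotor_potential dir f 0 (x, \<rho>') \<le> rotor_potential dir f 0 ((0, 0), \<rho>))"
proof -
  obtain x \<rho>' where loop:
    "while_option (\<lambda>(x, \<rho>'). x \<in> dom \<rho>') (rotor_step dir) ((0, 0), \<rho>) = Some (x, \<rho>')"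
    using deposit_loop_terminates[OF dir \<rho>] by (metis surj_pair)
  define inv where "inv = (\<lambda>(y :: site, \<rho>'). valid_config \<rho>' \<and> dom \<rho>' = dom \<rho> \<and>
    (\<forall>f. (\<forall>z\<in>dom \<rho>. (\<Sum>j<4. f (z + dir j)) \<le> 4 * f z) \<longrightarrow>
      rotor_potential dir f 0 (y, \<rho>') \<le> rotor_potential dir f 0 ((0, 0), \<rho>)))"
  have "inv (x, \<rho>')"
  proof (rule while_option_rule[OF _ loop])
    show "inv ((0, 0), \<rho>)"
      using \<rho> by (simp add: inv_def)
    fix s
    assume s: "inv s" "case s of (x, \<rho>') \<Rightarrow> x \<in> dom \<rho>'"
    obtain y \<sigma> where s_eq: "s = (y, \<sigma>)" by (cases s)
    have \<sigma>: "valid_config \<sigma>" "dom \<sigma> = dom \<rho>" "y \<in> dom \<sigma>"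
      using s by (auto simp: inv_def s_eq)
    obtain y' \<sigma>' where s': "rotor_step dir s = (y', \<sigma>')" by (cases "rotor_step dir s")
    have "\<sigma>' = \<sigma>(y \<mapsto> Suc (the (\<sigma> y)) mod 4)"
      using s' by (simp add: s_eq rotor_step_def)
    then have "valid_config \<sigma>'" "dom \<sigma>' = dom \<rho>"
      using \<sigma> by (simp_all add: valid_config_upd insert_absorb)
    moreover have "rotor_potential dir f 0 (y', \<sigma>') \<le> rotor_potential dir f 0 ((0, 0), \<rho>)"
      if f: "\<forall>z\<in>dom \<rho>. (\<Sum>j<4. f (z + dir j)) \<le> 4 * f z" for f
    proof -
      have "rotor_potential dir f 0 (y', \<sigma>') \<le> rotor_potential dir f 0 (y, \<sigma>)"
        using rotor_potential_step[OF \<sigma>(1,3), of f dir 0] f \<sigma> s' by (simp add: s_eq)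
      also have "\<dots> \<le> rotor_potential dir f 0 ((0, 0), \<rho>)"
        using s(1) f by (simp add: inv_def s_eq)
      finally show ?thesis .
    qed
    ultimately show "inv (rotor_step dir s)"
      by (simp add: inv_def s')
  qed
  moreover have "x \<notin> dom \<rho>'"
    using while_option_stop[OF loop] by simp
  ultimately show ?thesis
    using loop by (intro exI[of _ x] exI[of _ \<rho>']) (simp add: inv_def deposit_def)
qed

text \<open>Each new particle enters with potential \<open>f (0, 0)\<close> and settles with rotor
  0, hence with zero weight. Occupied sites stay occupied, so superharmonicity on the final domain
  gives it at every earlier stage of the induction.\<close>

lemma rotor_growth_invariant:
  assumes dir: "direction_order dir"
  shows "\<exists>\<rho>. rotor_growth dir m = Some \<rho> \<and> valid_config \<rho> \<and> card (dom \<rho>) = m \<and>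
    (\<forall>f. (\<forall>z\<in>dom \<rho>. (\<Sum>j<4. f (z + dir j)) \<le> 4 * f z) \<longrightarrow>
      (\<Sum>z\<in>dom \<rho>. f z + rotor_weight dir f 0 \<rho> z) \<le> real m * f (0, 0))"
proof (induction m)
  case 0
  then show ?case by (simp add: valid_config_def)
next
  case (Suc m)
  then obtain \<rho> where \<rho>: "rotor_growth dir m = Some \<rho>" "valid_config \<rho>" "card (dom \<rho>) = m"
    and bound: "\<And>f. \<forall>z\<in>dom \<rho>. (\<Sum>j<4. f (z + dir j)) \<le> 4 * f z \<Longrightarrow>
      (\<Sum>z\<in>dom \<rho>. f z + rotor_weight dir f 0 \<rho> z) \<le> real m * f (0, 0)"
    by blast
  have fin: "finite (dom \<rho>)"
    using \<rho>(2) by (simp add: valid_config_def)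
  obtain x \<rho>' where dep: "deposit dir \<rho> = Some (\<rho>'(x \<mapsto> 0))"
    and \<rho>': "valid_config \<rho>'" "dom \<rho>' = dom \<rho>" "x \<notin> dom \<rho>"
    and pot: "\<And>f. \<forall>z\<in>dom \<rho>. (\<Sum>j<4. f (z + dir j)) \<le> 4 * f z \<Longrightarrow>
      rotor_potential dir f 0 (x, \<rho>') \<le> rotor_potential dir f 0 ((0, 0), \<rho>)"
    using deposit_invariant[OF dir \<rho>(2)] by blast
  have dom: "dom (\<rho>'(x \<mapsto> 0)) = insert x (dom \<rho>)"
    using \<rho>'(2) by simp
  have "(\<Sum>z\<in>insert x (dom \<rho>). f z + rotor_weight dir f 0 (\<rho>'(x \<mapsto> 0)) z) \<le> real (Suc m) * f (0, 0)"
    if f: "\<forall>z\<in>insert x (dom \<rho>). (\<Sum>j<4. f (z + dir j)) \<le> 4 * f z" for f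
  proof -
    have "(\<Sum>z\<in>dom \<rho>. rotor_weight dir f 0 (\<rho>'(x \<mapsto> 0)) z) = (\<Sum>z\<in>dom \<rho>. rotor_weight dir f 0 \<rho>' z)"
      using \<rho>'(3) by (intro sum.cong) (auto simp: rotor_weight_def)
    moreover have "rotor_weight dir f 0 (\<rho>'(x \<mapsto> 0)) x = 0"
      by (simp add: rotor_weight_def)
    moreover have "f x + (\<Sum>z\<in>dom \<rho>. rotor_weight dir f 0 \<rho>' z)
        \<le> f (0, 0) + (\<Sum>z\<in>dom \<rho>. rotor_weight dir f 0 \<rho> z)"
      using pot[of f] f \<rho>'(2) by (simp add: rotor_potential_def)
    moreover have "(\<Sum>z\<in>dom \<rho>. f z + rotor_weight dir f 0 \<rho> z) \<le> real m * f (0, 0)"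
      using bound f by simp
    ultimately show ?thesis
      using fin \<rho>'(3) by (simp add: sum.distrib algebra_simps)
  qed
  moreover have "rotor_growth dir (Suc m) = Some (\<rho>'(x \<mapsto> 0))"
    using \<rho>(1) dep by simp
  moreover have "valid_config (\<rho>'(x \<mapsto> 0))"
    using \<rho>'(1) by (rule valid_config_upd) simp
  moreover have "card (insert x (dom \<rho>)) = Suc m"
    using \<rho>(3) \<rho>'(3) fin by simp
  ultimately show ?case
    unfolding dom[symmetric] by blast
qed

section \<open>A discrete superharmonic logarithm\<close>

text \<open>Any positive value up to \<open>1/126\<close> at the origin keeps \<open>ln \<circ> shifted_norm\<close> superharmonic at the
  neighbours of the origin.\<close>

definition shifted_norm :: "site \<Rightarrow> real" where
  "shifted_norm = (\<lambda>(x, y). if x = 0 \<and> y = 0 then 1 / 126 else of_int x ^ 2 + of_int y ^ 2 - 1 / 2)"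

lemma int_norm_ge_1: "(x, y) \<noteq> (0, 0) \<Longrightarrow> 1 \<le> (of_int x :: real) ^ 2 + of_int y ^ 2"
proof -
  assume "(x, y) \<noteq> (0, 0)"
  then have "0 < x ^ 2 + y ^ 2"
    by (auto simp: sum_power2_gt_zero_iff)
  then have "1 \<le> x ^ 2 + y ^ 2" by linarith
  then have "real_of_int 1 \<le> of_int (x ^ 2 + y ^ 2)" by (simp only: of_int_le_iff)
  then show ?thesis by simp
qed

lemma shifted_norm_ge_half: "z \<noteq> (0, 0) \<Longrightarrow> 1 / 2 \<le> shifted_norm z"
  using int_norm_ge_1[of "fst z" "snd z"] by (cases z) (auto simp: shifted_norm_def)

lemma shifted_norm_pos: "0 < shifted_norm z"
  using shifted_norm_ge_half[of z] by (cases "z = (0, 0)") (auto simp: shifted_norm_def)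

lemma shifted_norm_prod_le:
  assumes "z \<noteq> (0, 0)"
  shows "shifted_norm (z + (1, 0)) * shifted_norm (z + (-1, 0)) *
    shifted_norm (z + (0, 1)) * shifted_norm (z + (0, -1)) \<le> shifted_norm z ^ 4"
proof (cases "z \<in> E2")
  \<comment> \<open>Next to the origin the product is 7/2 * 3/2 * 3/2 * 1/126 = 1/16, which equals
    \<open>shifted_norm z ^ 4\<close>: the value 1/126 is extremal.\<close>
  case True
  then show ?thesis
    by (auto simp: E2_def shifted_norm_def power2_eq_square eval_nat_numeral)
next
  case False
  obtain x y where z: "z = (x, y)" by force
  have "shifted_norm (z + (1, 0)) = (of_int x + 1) ^ 2 + of_int y ^ 2 - 1 / 2"
    "shifted_norm (z + (-1, 0)) = (of_int x - 1) ^ 2 + of_int y ^ 2 - 1 / 2"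
    "shifted_norm (z + (0, 1)) = of_int x ^ 2 + (of_int y + 1) ^ 2 - 1 / 2"
    "shifted_norm (z + (0, -1)) = of_int x ^ 2 + (of_int y - 1) ^ 2 - 1 / 2"
    "shifted_norm z = of_int x ^ 2 + of_int y ^ 2 - 1 / 2"
    using False assms by (auto simp: z E2_def shifted_norm_def)
  \<comment> \<open>No neighbour is the origin here. With N = a^2 + b^2 - 1/2 the factors are N + 1
    +- 2a and N + 1 +- 2b, with product N^4 - (2N + 1)^2 + 16 a^2 b^2. The shift by 1/2 makes 2N + 1
    = 2 (a^2 + b^2), which leaves a perfect square.\<close>
  moreover have "((a + 1) ^ 2 + b ^ 2 - 1 / 2) * ((a - 1) ^ 2 + b ^ 2 - 1 / 2) *
      (a ^ 2 + (b + 1) ^ 2 - 1 / 2) * (a ^ 2 + (b - 1) ^ 2 - 1 / 2)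
      = (a ^ 2 + b ^ 2 - 1 / 2) ^ 4 - 4 * (a ^ 2 - b ^ 2) ^ 2" for a b :: real
    by (simp add: field_simps eval_nat_numeral)
  ultimately show ?thesis
    by simp
qed

lemma ln_shifted_norm_superharmonic:
  assumes "direction_order dir" "z \<noteq> p"
  shows "(\<Sum>j<4. ln (shifted_norm (z + dir j - p))) \<le> 4 * ln (shifted_norm (z - p))"
proof -
  define v where "v = z - p"
  have "v \<noteq> (0, 0)"
    using assms(2) by (auto simp: v_def zero_prod_def[symmetric])
  then have "ln (shifted_norm (v + (1, 0)) * shifted_norm (v + (-1, 0)) *
      shifted_norm (v + (0, 1)) * shifted_norm (v + (0, -1))) \<le> ln (shifted_norm v ^ 4)"
    by (intro ln_mono shifted_norm_prod_le mult_pos_pos zero_less_power shifted_norm_pos)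
  then have "(\<Sum>e\<in>E2. ln (shifted_norm (v + e))) \<le> 4 * ln (shifted_norm v)"
    unfolding sum_E2
    by (simp add: ln_mult_pos ln_realpow shifted_norm_pos)
  then show ?thesis
    using sum_dir[OF assms(1), of "\<lambda>e. ln (shifted_norm (v + e))"]
    by (simp add: v_def diff_add_eq)
qed

text \<open>This bounds each term of an unfinished rotor turn. Since an integer satisfies |i| <=
  i^2, a step raises the squared norm n to at most 3n + 1, and 3n + 1/2 <= 7 (n - 1/2) for n >= 1.
  Equality occurs from (1, 0) to (2, 0).\<close>

lemma shifted_norm_neighbour_le:
  assumes "z \<noteq> (0, 0)" "e \<in> E2"
  shows "shifted_norm (z + e) \<le> 7 * shifted_norm z"
proof (cases "z + e = (0, 0)")
  case True
  then show ?thesis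
    using shifted_norm_ge_half[OF assms(1)] by (simp add: shifted_norm_def)
next
  case False
  obtain x y where z: "z = (x, y)" by force
  have abs_le: "\<bar>real_of_int i\<bar> \<le> of_int i ^ 2" for i
  proof -
    have "\<bar>i\<bar> * 1 \<le> \<bar>i\<bar> * \<bar>i\<bar>"
      by (cases "i = 0", simp, intro mult_left_mono, auto)
    then have "\<bar>i\<bar> \<le> i ^ 2" by (simp add: power2_eq_square)
    then have "real_of_int \<bar>i\<bar> \<le> of_int (i ^ 2)" by (simp only: of_int_le_iff)
    then show ?thesis by simp
  qed
  have "1 \<le> (of_int x :: real) ^ 2 + of_int y ^ 2"
    using int_norm_ge_1 assms(1) z by simp
  moreover have "shifted_norm (z + e) \<le> 3 * (of_int x ^ 2 + of_int y ^ 2) + 1 / 2"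
    using assms(2) False abs_le[of x] abs_le[of y] zero_le_power2[of "real_of_int x"]
      zero_le_power2[of "real_of_int y"]
    unfolding E2_def z shifted_norm_def
    by (auto simp: power2_eq_square algebra_simps abs_if split: if_splits)
  ultimately show ?thesis
    using assms(1) by (auto simp: z shifted_norm_def)
qed

section \<open>Counting sites\<close>

text \<open>Sites outside the square of half-side \<open>L\<close> about \<open>p\<close> contribute
  at least \<open>2 * ln L\<close> each. The at most \<open>(2 * L + 1) ^ 2\<close> sites inside
  contribute at least -1 each, a shortfall of \<open>2 * ln L + 1\<close>.\<close>

lemma sum_ln_shifted_norm_ge:
  assumes D: "finite D" "p \<notin> D" and L: "1 \<le> L"
  shows "real (card D) * (2 * ln (real L)) - real ((2 * L + 1) ^ 2) * (2 * ln (real L) + 1)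
    \<le> (\<Sum>z\<in>D. ln (shifted_norm (z - p)))"
proof -
  define S where "S = {fst p - int L..fst p + int L} \<times> {snd p - int L..snd p + int L}"
  have lnL: "0 \<le> ln (real L)"
    using L by simp
  have "nat (2 * int L + 1) = 2 * L + 1"
    by linarith
  then have "card S = (2 * L + 1) ^ 2"
    by (simp add: S_def card_cartesian_product power2_eq_square)
  then have card: "card (D \<inter> S) \<le> (2 * L + 1) ^ 2"
    by (metis S_def card_mono finite_SigmaI finite_atLeastAtMost_int inf_le2)
  \<comment> \<open>The left side is -1, written to match the summand with \<open>if\<close> below.
    Vacancy of \<open>p\<close> matters: the logarithm of 1/126 is below -1.\<close>
  have near: "2 * ln (real L) - (2 * ln (real L) + 1) \<le> ln (shifted_norm (z - p))" if "z \<in> D" for z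
  proof -
    have "z - p \<noteq> (0, 0)"
      using D(2) that by (auto simp: zero_prod_def[symmetric])
    then have "ln (1 / 2) \<le> ln (shifted_norm (z - p))"
      using shifted_norm_ge_half by (intro ln_mono) auto
    moreover have "- 1 \<le> ln (1 / 2 :: real)"
      using ln_le_minus_one[of 2] by (simp add: ln_div)
    ultimately show ?thesis by simp
  qed
  have far: "2 * ln (real L) \<le> ln (shifted_norm (z - p))" if "z \<notin> S" for z
  proof -
    obtain x y where z: "z - p = (x, y)" by force
    have "int L + 1 \<le> \<bar>x\<bar> \<or> int L + 1 \<le> \<bar>y\<bar>"
      using that z by (cases z; cases p) (auto simp: S_def)
    then have "real L + 1 \<le> \<bar>of_int x\<bar> \<or> real L + 1 \<le> \<bar>of_int y\<bar>"
      by linarith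
    then have "(real L + 1) ^ 2 \<le> of_int x ^ 2 \<or> (real L + 1) ^ 2 \<le> of_int y ^ 2"
      by (metis abs_le_square_iff abs_of_nonneg add_nonneg_nonneg of_nat_0_le_iff zero_le_one)
    then have "(real L + 1) ^ 2 \<le> of_int x ^ 2 + of_int y ^ 2"
      by (smt (verit) zero_le_power2)
    then have "real L ^ 2 \<le> of_int x ^ 2 + of_int y ^ 2 - 1 / 2"
      by (simp add: power2_eq_square algebra_simps)
    moreover have "\<not> (x = 0 \<and> y = 0)"
      using \<open>int L + 1 \<le> \<bar>x\<bar> \<or> int L + 1 \<le> \<bar>y\<bar>\<close> by auto
    ultimately have "real L ^ 2 \<le> shifted_norm (z - p)"
      by (auto simp add: z shifted_norm_def)
    then have "ln (real L ^ 2) \<le> ln (shifted_norm (z - p))"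
      using L by (intro ln_mono) auto
    then show ?thesis
      using L by (simp add: ln_realpow)
  qed
  have "real (card (D \<inter> S)) * (2 * ln (real L) + 1) \<le> real ((2 * L + 1) ^ 2) * (2 * ln (real L) + 1)"
    using card lnL by (intro mult_right_mono of_nat_mono) auto
  moreover have "(\<Sum>z\<in>D. 2 * ln (real L) - (if z \<in> S then 2 * ln (real L) + 1 else 0))
      \<le> (\<Sum>z\<in>D. ln (shifted_norm (z - p)))"
    using near far by (intro sum_mono) auto
  moreover have "(\<Sum>z\<in>D. 2 * ln (real L) - (if z \<in> S then 2 * ln (real L) + 1 else 0))
      = real (card D) * (2 * ln (real L)) - real (card (D \<inter> S)) * (2 * ln (real L) + 1)"
    using D(1) by (simp add: sum_subtractf sum.If_cases Int_def)
  ultimately show ?thesis by linarith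
qed

section \<open>Vacant sites are far from the origin\<close>

lemma vacant_sum_ln_le:
  assumes dir: "direction_order dir" and \<rho>: "rotor_growth dir m = Some \<rho>" and p: "p \<notin> dom \<rho>"
  shows "(\<Sum>z\<in>dom \<rho>. ln (shifted_norm (z - p)))
    \<le> real m * (ln (shifted_norm ((0, 0) - p)) + 4 * ln 7)"
proof -
  define f where "f z = ln (shifted_norm (z - p))" for z
  have "\<forall>z\<in>dom \<rho>. (\<Sum>j<4. f (z + dir j)) \<le> 4 * f z"
    unfolding f_def using p by (intro ballI ln_shifted_norm_superharmonic[OF dir]) metis
  then have val: "valid_config \<rho>" and card: "card (dom \<rho>) = m"
    and bound: "(\<Sum>z\<in>dom \<rho>. f z + rotor_weight dir f 0 \<rho> z) \<le> real m * f (0, 0)"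
    using rotor_growth_invariant[OF dir, of m] \<rho> by auto
  \<comment> \<open>An unfinished turn has fewer than four terms, each at least
    \<open>- ln 7\<close>.\<close>
  have weight: "- (4 * ln 7) \<le> rotor_weight dir f 0 \<rho> z" if z: "z \<in> dom \<rho>" for z
  proof -
    define k where "k = the (\<rho> z)"
    have "k < 4"
      using val z by (auto simp: valid_config_def k_def)
    have "z - p \<noteq> (0, 0)"
      using z p by (auto simp: zero_prod_def[symmetric])
    have "- ln 7 \<le> f z - f (z + dir j) + 0" if "j < k" for j
    proof -
      have "dir j \<in> E2"
        using dir that \<open>k < 4\<close> by (auto simp: direction_order_def bij_betw_def)
      then have "shifted_norm (z - p + dir j) \<le> 7 * shifted_norm (z - p)"
        using \<open>z - p \<noteq> (0, 0)\<close> shifted_norm_neighbour_le by blast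
      then have "ln (shifted_norm (z - p + dir j)) \<le> ln (7 * shifted_norm (z - p))"
        by (intro ln_mono) (auto simp: shifted_norm_pos)
      then show ?thesis
        by (simp add: f_def ln_mult_pos shifted_norm_pos diff_add_eq)
    qed
    then have "(\<Sum>j<k. - ln 7) \<le> rotor_weight dir f 0 \<rho> z"
      unfolding rotor_weight_def k_def by (intro sum_mono) auto
    moreover have "(\<Sum>j<k. - ln 7) = - (real k * ln 7)"
      by simp
    moreover have "real k * ln 7 \<le> 4 * ln 7"
      using \<open>k < 4\<close> by (intro mult_right_mono) auto
    ultimately show ?thesis by linarith
  qed
  have "(\<Sum>z\<in>dom \<rho>. f z - 4 * ln 7) \<le> (\<Sum>z\<in>dom \<rho>. f z + rotor_weight dir f 0 \<rho> z)"
    using weight by (intro sum_mono) (smt (verit))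
  then show ?thesis
    using bound card by (simp add: sum_subtractf f_def algebra_simps)
qed

lemma rotor_growth_occupied:
  assumes dir: "direction_order dir" and \<rho>: "rotor_growth dir m = Some \<rho>"
    and m: "64 * (exp 24 + 1) ^ 2 \<le> real m"
    and p: "(of_int (fst p) ^ 2 + of_int (snd p) ^ 2 :: real) \<le> sqrt (real m)"
  shows "p \<in> dom \<rho>"
proof (rule ccontr)
  assume vacant: "p \<notin> dom \<rho>"
  \<comment> \<open>With \<open>L\<close> near sqrt m / 8 the square about \<open>p\<close> holds at
    most 9/64 of \<open>m\<close> sites, so the loss \<open>9 / 64 * 2 * l\<close> per particle
    stays below the surplus \<open>l\<close> of \<open>2 * l\<close> over the logarithm at the
    origin.\<close>
  define L where "L = nat \<lfloor>sqrt (real m) / 8\<rfloor>"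
  define l where "l = ln (real L)"
  define E :: real where "E = exp 24"
  have "1 \<le> E"
    by (simp add: E_def)
  have "sqrt (64 * (E + 1) ^ 2) \<le> sqrt (real m)"
    using m by (simp only: E_def real_sqrt_le_iff)
  then have sqrt_m: "8 * (E + 1) \<le> sqrt (real m)"
    using \<open>1 \<le> E\<close> by (simp add: real_sqrt_mult)
  have L_le: "8 * real L \<le> sqrt (real m)"
    unfolding L_def by simp linarith
  have L_ge: "sqrt (real m) < 8 * (real L + 1)"
    unfolding L_def by simp linarith
  have "E \<le> real L"
    using le_less_trans[OF sqrt_m L_ge] by simp
  then have L1: "1 \<le> real L"
    using \<open>1 \<le> E\<close> by linarith
  \<comment> \<open>The final comparison forces \<open>l\<close> <= 1033/46 < 23; the threshold with
    \<open>exp 24\<close> is chosen to contradict this.\<close>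
  have l: "24 \<le> l"
    unfolding l_def using \<open>E \<le> real L\<close> L1 by (simp add: ln_ge_iff E_def)
  have m1: "1 \<le> sqrt (real m)"
    using order_trans[OF _ sqrt_m, of 1] \<open>1 \<le> E\<close> by simp
  have mpos: "0 < real m"
    using m1 by (cases "m = 0") auto
  have "(8 * real L) ^ 2 \<le> sqrt (real m) ^ 2"
    using L_le by (intro power_mono) auto
  then have L_sq: "64 * real L ^ 2 \<le> real m"
    by (simp add: power_mult_distrib)
  have "(2 * real L + 1) ^ 2 \<le> (3 * real L) ^ 2"
    using L1 by (intro power_mono) auto
  then have near: "64 * (2 * real L + 1) ^ 2 \<le> 9 * real m"
    using L_sq by (simp add: power_mult_distrib)
  \<comment> \<open>The squared norm of \<open>p\<close> is at most sqrt m < 8 (L + 1) <= 16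
    L.\<close>
  have "shifted_norm ((0, 0) - p) \<le> 16 * real L"
    using p m1 L1 L_ge by (cases p) (auto simp: shifted_norm_def)
  then have "ln (shifted_norm ((0, 0) - p)) \<le> ln (16 * real L)"
    by (intro ln_mono shifted_norm_pos)
  also have "\<dots> = ln 16 + l"
    using L1 by (simp add: l_def ln_mult_pos)
  finally have ln_p: "ln (shifted_norm ((0, 0) - p)) \<le> ln 16 + l" .
  have "ln (16 :: real) = 4 * ln 2"
    using ln_realpow[of "2::real" 4] by simp
  then have ln16: "ln (16 :: real) \<le> 4"
    using ln_le_minus_one[of "2::real"] by simp
  have "ln (7 :: real) \<le> ln (2 ^ 3)"
    by (intro ln_mono) auto
  also have "\<dots> \<le> 3"
    using ln_le_minus_one[of "2::real"] by (simp only: ln_realpow) simp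
  finally have ln7: "ln (7 :: real) \<le> 3" .
  obtain fin: "finite (dom \<rho>)" and card: "card (dom \<rho>) = m"
    using rotor_growth_invariant[OF dir, of m] \<rho> by (auto simp: valid_config_def)
  have "real m * (2 * l) - (2 * real L + 1) ^ 2 * (2 * l + 1)
      \<le> real m * (ln (shifted_norm ((0, 0) - p)) + 4 * ln 7)"
    using sum_ln_shifted_norm_ge[OF fin vacant, of L] vacant_sum_ln_le[OF dir \<rho> vacant] L1 card
    by (simp add: l_def add.commute)
  also have "\<dots> \<le> real m * (l + 16)"
    using ln_p ln16 ln7 by (intro mult_left_mono) auto
  finally have "real m * (2 * l) \<le> real m * (l + 16) + (2 * real L + 1) ^ 2 * (2 * l + 1)"
    by simp
  also have "(2 * real L + 1) ^ 2 * (2 * l + 1) \<le> (9 / 64 * real m) * (2 * l + 1)"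
    using near l by (intro mult_right_mono) auto
  finally have "real m * (2 * l) \<le> real m * (l + 16 + 9 / 64 * (2 * l + 1))"
    by (simp add: algebra_simps)
  then have "2 * l \<le> l + 16 + 9 / 64 * (2 * l + 1)"
    using mpos by (simp only: mult_le_cancel_left_pos)
  then show False
    using l by (simp add: field_simps)
qed

theorem theorem4p6:
  fixes \<epsilon> :: real
  assumes "\<epsilon> > 0"
  shows "\<exists>M::nat. \<forall>dir. direction_order dir \<longrightarrow> (\<forall>m\<ge>M.
    \<exists>\<rho>. rotor_growth dir m = Some \<rho> \<and>
      (\<forall>x y :: int. (real_of_int x, real_of_int y)
          \<in> ball (0, 0) ((8 * real m / (3 * exp (6 + \<epsilon>))) powr (1 / 4))
        \<longrightarrow> (x, y) \<in> dom \<rho>))"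
proof -
  define M where "M = nat \<lceil>64 * (exp 24 + 1) ^ 2 :: real\<rceil>"
  have "\<exists>\<rho>. rotor_growth dir m = Some \<rho> \<and>
      (\<forall>x y :: int. (real_of_int x, real_of_int y)
          \<in> ball (0, 0) ((8 * real m / (3 * exp (6 + \<epsilon>))) powr (1 / 4))
        \<longrightarrow> (x, y) \<in> dom \<rho>)" if dir: "direction_order dir" and "M \<le> m" for dir m
  proof -
    have m: "64 * (exp 24 + 1) ^ 2 \<le> real m"
      using that(2) unfolding M_def by linarith
    obtain \<rho> where \<rho>: "rotor_growth dir m = Some \<rho>"
      using rotor_growth_invariant[OF dir] by blast
    define r where "r = (8 * real m / (3 * exp (6 + \<epsilon>))) powr (1 / 4)"
    \<comment> \<open>As exp (6 + \<epsilon>) >= 7 + \<epsilon>, the base of the power is at most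
      \<open>m\<close>, so the disc lies within radius m^(1/4).\<close>
    have "8 / 3 \<le> exp (6 + \<epsilon>)"
      using exp_ge_add_one_self[of "6 + \<epsilon>"] assms by linarith
    then have "real m * 8 \<le> real m * (3 * exp (6 + \<epsilon>))"
      by (intro mult_left_mono) auto
    then have "8 * real m / (3 * exp (6 + \<epsilon>)) \<le> real m"
      by (simp add: field_simps)
    then have "r \<le> real m powr (1 / 4)"
      unfolding r_def by (intro powr_mono2) auto
    then have "r ^ 2 \<le> (real m powr (1 / 4)) ^ 2"
      by (intro power_mono) (auto simp: r_def)
    also have "\<dots> = sqrt (real m)"
      by (simp add: power2_eq_square powr_half_sqrt flip: powr_add)
    finally have r: "r ^ 2 \<le> sqrt (real m)" .
    have "(x, y) \<in> dom \<rho>" if "(real_of_int x, real_of_int y) \<in> ball (0, 0) r" for x y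
    proof (rule rotor_growth_occupied[OF dir \<rho> m])
      have "sqrt ((of_int x) ^ 2 + (of_int y) ^ 2) < r"
        using that by (simp add: dist_Pair_Pair)
      then have "sqrt ((of_int x) ^ 2 + (of_int y) ^ 2) ^ 2 \<le> r ^ 2"
        by (intro power_mono) auto
      then show "(of_int (fst (x, y)) ^ 2 + of_int (snd (x, y)) ^ 2 :: real) \<le> sqrt (real m)"
        using r by simp
    qed
    then show ?thesis
      using \<rho> by (auto simp: r_def)
  qed
  then show ?thesis by blast
qed

end
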